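(* Let $\varepsilon>0$, let $D>0$, and let $i,j\ge 2$ be integers. Put $C_{i,j}=\log 2\,\big(\frac1i+\frac1j\big)$ and $$h(x)=\exp\Big((C_{i,j}+2\varepsilon)\frac{\log x}{\log\log x}\Big).$$ Then there exist constants $E,N>0$, depending only on $\varepsilon$ and $D$, such that for every real $x>N$, $$\sum_{x<n\le x+h(x)}\exp(-D\,d_{i,j}(n))\ \ge\ E\exp\Big((C_{i,j}+\varepsilon)\frac{\log x}{\log\log x}\Big).$$
   Context: $\mathbb{N}$ denotes the positive integers and $\log$ is the natural logarithm. For $i,j,n\in\mathbb{N}$, $d_{i,j}(n)$ is the number of pairs $(a,b)\in\mathbb{N}^2$ with $a^i b^j\mid n$. The sum runs over integers $n$ in the interval $(x,x+h(x)]$. *)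

theory Defs
  imports Complex_Main
begin

text \<open>Intended for positive \<open>i\<close>, \<open>j\<close>, \<open>n\<close>, where the set is finite; for \<open>n = 0\<close> it is
  infinite and \<^const>\<open>card\<close> returns \<open>0\<close>.\<close>

definition d :: "nat \<Rightarrow> nat \<Rightarrow> nat \<Rightarrow> nat" where
  "d i j n = card {(a, b). a > 0 \<and> b > 0 \<and> a ^ i * b ^ j dvd n}"

definition C :: "nat \<Rightarrow> nat \<Rightarrow> real" where
  "C i j = ln 2 * (1 / real i + 1 / real j)"

definition h :: "real \<Rightarrow> nat \<Rightarrow> nat \<Rightarrow> real \<Rightarrow> real" where
  "h \<epsilon> i j x = exp ((C i j + 2 * \<epsilon>) * (ln x / ln (ln x)))"

end

theory Submission
  imports Defs "HOL-Computational_Algebra.Primes" "HOL-Real_Asymp.Real_Asymp"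
begin

text \<open>
  Discard from the interval every \<open>n\<close> divisible by a square \<open>a\<^sup>2\<close> with \<open>2 \<le> a \<le> z = h(x)/16\<close>.
  Since \<open>\<Sum>a\<ge>2. 1/a\<^sup>2 \<le> 3/4\<close>, this removes at most \<open>3h/4 + z\<close> integers and at least \<open>h/8\<close> of them
  survive. For a surviving \<open>n\<close>, every prime \<open>p\<close> with \<open>p\<^sup>i dvd n\<close> exceeds \<open>z\<close>, so at most
  \<open>2 powr (ln n / (i ln z))\<close> integers \<open>a\<close> satisfy \<open>a\<^sup>i dvd n\<close>. Hence \<open>d\<^sub>i\<^sub>,\<^sub>j(n) \<le> exp (C ln n / ln z)\<close>,
  which is a power of \<open>ln x\<close> with exponent bounded away from \<open>1\<close>, uniformly in \<open>i\<close> and \<open>j\<close>; it is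
  therefore negligible against \<open>ln x / ln (ln x)\<close>.
\<close>

section \<open>Bounding the number of power divisors\<close>

lemma finite_power_divisors:
  fixes n i :: nat
  assumes "n > 0" "i > 0"
  shows "finite {a. a ^ i dvd n}"
proof (rule finite_subset)
  show "{a. a ^ i dvd n} \<subseteq> {..n}"
  proof
    fix a assume "a \<in> {a. a ^ i dvd n}"
    then have "a ^ i \<le> n" using assms by (auto intro: dvd_imp_le)
    moreover have "a \<le> a ^ i" using assms by (cases "a = 0") (auto intro: self_le_power)
    ultimately show "a \<in> {..n}" by simp
  qed
qed simp

text \<open>Strong induction, splitting off \<open>p ^ i\<close> with \<open>n = p ^ i * m\<close>.
  If \<open>a ^ i dvd n\<close>, then either \<open>a = p * b\<close> with
  \<open>b ^ i dvd m\<close>, or \<open>a\<close> is coprime to \<open>p\<close> and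
  \<open>a ^ i dvd m\<close>. So the count at most doubles from \<open>m\<close> to
  \<open>n\<close>, while the bound gains a factor \<open>p powr (i * t)\<close>, where
  \<open>t\<close> is the exponent for which \<open>z powr (i * t) = 2\<close>.\<close>

lemma card_power_divisors_le:
  fixes n i :: nat and z :: real
  assumes "n > 0" "i > 0" "z > 1"
    and "\<And>p. prime p \<Longrightarrow> p ^ i dvd n \<Longrightarrow> real p \<ge> z"
  shows "real (card {a. a ^ i dvd n}) \<le> real n powr (ln 2 / (real i * ln z))"
  using assms
proof (induction n rule: less_induct)
  case (less n)
  define t where "t = ln 2 / (real i * ln z)"
  have t: "t \<ge> 0" using less.prems by (simp add: t_def)
  show ?case
  proof (cases "\<exists>p. prime p \<and> p ^ i dvd n")
    case False
    have "{a. a ^ i dvd n} \<subseteq> {1}"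
    proof
      fix a assume a: "a \<in> {a. a ^ i dvd n}"
      show "a \<in> {1}"
      proof (rule ccontr)
        assume "a \<notin> {1}"
        then obtain p where "prime p" "p dvd a" using prime_factor_nat[of a] by auto
        then show False using False a dvd_trans[OF dvd_power_same[of p a i]] by auto
      qed
    qed
    then have "card {a. a ^ i dvd n} \<le> card {1::nat}" by (intro card_mono) auto
    then have "real (card {a. a ^ i dvd n}) \<le> 1" by simp
    also have "1 \<le> real n powr t"
      using t less.prems by (intro ge_one_powr_ge_zero) auto
    finally show ?thesis by (simp add: t_def)
  next
    case True
    then obtain p where p: "prime p" "p ^ i dvd n" by blast
    then obtain m where m: "n = p ^ i * m" by blast
    have p1: "p > 1" using p prime_gt_1_nat by blast
    have m0: "m > 0" using m less.prems by (cases m) auto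
    have "p ^ i > 1" using p1 less.prems by (intro one_less_power) auto
    then have mn: "m < n" using m m0 by simp
    have IH: "real (card {a. a ^ i dvd m}) \<le> real m powr t"
      unfolding t_def using less.prems m
      by (intro less.IH[OF mn m0]) auto
    let ?S = "{a. a ^ i dvd m}"
    have fin: "finite ?S" using finite_power_divisors m0 less.prems by auto
    have "{a. a ^ i dvd n} \<subseteq> ?S \<union> (*) p ` ?S"
    proof
      fix a assume a: "a \<in> {a. a ^ i dvd n}"
      show "a \<in> ?S \<union> (*) p ` ?S"
      proof (cases "p dvd a")
        case True
        then obtain b where b: "a = p * b" by blast
        have "b ^ i dvd m" using a p1 by (simp add: b m power_mult_distrib)
        then show ?thesis using b by blast
      next
        case False
        then have "coprime p a" using p prime_imp_coprime by blast
        then have "coprime (a ^ i) (p ^ i)" by (simp add: coprime_commute)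
        then show ?thesis using a by (simp add: m coprime_dvd_mult_right_iff)
      qed
    qed
    then have "card {a. a ^ i dvd n} \<le> card (?S \<union> (*) p ` ?S)"
      using fin by (intro card_mono) auto
    also have "\<dots> \<le> card ?S + card ((*) p ` ?S)" by (rule card_Un_le)
    also have "\<dots> \<le> 2 * card ?S" using card_image_le[OF fin, of "(*) p"] by simp
    finally have "real (card {a. a ^ i dvd n}) \<le> 2 * real (card ?S)" by linarith
    also have "\<dots> \<le> 2 * real m powr t" using IH by simp
    also have "2 = z powr (real i * t)"
      using less.prems by (simp add: powr_def t_def)
    also have "\<dots> \<le> real p powr (real i * t)"
      using less.prems p t by (intro powr_mono2) auto
    also have "\<dots> = real (p ^ i) powr t"
      using p1 by (simp add: powr_powr[symmetric] powr_realpow)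
    also have "\<dots> * real m powr t = real n powr t"
      by (simp add: m powr_mult)
    finally show ?thesis by (simp add: t_def mult_right_mono)
  qed
qed

lemma d_le_powr:
  fixes n i j :: nat and z :: real
  assumes "n > 0" "i \<ge> 2" "j \<ge> 2" "z > 1"
    and sq: "\<And>p. prime p \<Longrightarrow> p\<^sup>2 dvd n \<Longrightarrow> real p \<ge> z"
  shows "real (d i j n) \<le> real n powr (C i j / ln z)"
proof -
  \<comment> \<open>Since \<open>k \<ge> 2\<close>, \<open>p ^ k dvd n\<close> implies that the
    square of \<open>p\<close> divides \<open>n\<close>, so one hypothesis on squares serves both
    exponents.\<close>
  have *: "real (card {a. a ^ k dvd n}) \<le> real n powr (ln 2 / (real k * ln z))" if "k \<ge> 2" for k
    using assms that dvd_trans[OF le_imp_power_dvd[OF that]]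
    by (intro card_power_divisors_le) auto
  have "{(a, b). a > 0 \<and> b > 0 \<and> a ^ i * b ^ j dvd n} \<subseteq> {a. a ^ i dvd n} \<times> {b. b ^ j dvd n}"
    by (auto dest: dvd_mult_left dvd_mult_right)
  then have "d i j n \<le> card ({a. a ^ i dvd n} \<times> {b. b ^ j dvd n})"
    unfolding d_def using assms finite_power_divisors by (intro card_mono) auto
  then have "real (d i j n) \<le> real (card {a. a ^ i dvd n}) * real (card {b. b ^ j dvd n})"
    by (simp add: card_cartesian_product flip: of_nat_mult)
  also have "\<dots> \<le> real n powr (ln 2 / (real i * ln z)) * real n powr (ln 2 / (real j * ln z))"
    using * assms by (intro mult_mono) auto
  also have "\<dots> = real n powr (C i j / ln z)"
    using assms by (simp add: C_def powr_add[symmetric] field_simps)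
  finally show ?thesis .
qed

section \<open>Sieving a short interval by squares\<close>

lemma nat_interval_eq:
  fixes x t :: real
  assumes "x \<ge> 0" "t \<ge> 0"
  shows "{n :: nat. x < real n \<and> real n \<le> x + t} = {nat \<lfloor>x\<rfloor><..nat \<lfloor>x + t\<rfloor>}"
proof -
  have "x < real n \<longleftrightarrow> nat \<lfloor>x\<rfloor> < n" for n using assms by linarith
  moreover have "real n \<le> x + t \<longleftrightarrow> n \<le> nat \<lfloor>x + t\<rfloor>" for n using assms by linarith
  ultimately show ?thesis by auto
qed

lemma card_nat_interval:
  fixes x t :: real
  assumes "x \<ge> 0" "t \<ge> 0"
  shows "finite {n :: nat. x < real n \<and> real n \<le> x + t}"
    and "real (card {n :: nat. x < real n \<and> real n \<le> x + t}) \<ge> t - 1"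
    and "real (card {n :: nat. x < real n \<and> real n \<le> x + t}) \<le> t + 1"
  unfolding nat_interval_eq[OF assms] using assms by simp_all linarith+

lemma card_multiples_in_interval_le:
  fixes x t :: real and k :: nat
  assumes "x \<ge> 0" "t \<ge> 0" "k > 0"
  shows "real (card {n :: nat. x < real n \<and> real n \<le> x + t \<and> k dvd n}) \<le> t / real k + 1"
proof -
  let ?M = "{m :: nat. x / k < real m \<and> real m \<le> x / k + t / k}"
  have "{n :: nat. x < real n \<and> real n \<le> x + t \<and> k dvd n} \<subseteq> (*) k ` ?M"
    using assms by (auto simp: field_simps elim!: dvdE)
  then have "card {n :: nat. x < real n \<and> real n \<le> x + t \<and> k dvd n} \<le> card ?M"
    using assms by (intro surj_card_le card_nat_interval) auto
  also have "real (card ?M) \<le> t / k + 1"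
    using assms by (intro card_nat_interval) auto
  finally show ?thesis by simp
qed

lemma sum_inverse_squares_le: "(\<Sum>a = 2..m. 1 / (real a)\<^sup>2) \<le> 3 / 4"
proof -
  \<comment> \<open>The subtracted term makes the induction telescope; at \<open>m = 0\<close> the
    bound is the equality \<open>1/4 = 3/4 - 1/2\<close>.\<close>
  have "(\<Sum>a = 2..m + 2. 1 / (real a)\<^sup>2) \<le> 3 / 4 - 1 / real (m + 2)" for m
  proof (induction m)
    case (Suc m)
    have "1 / (real (m + 3))\<^sup>2 \<le> 1 / real (m + 2) - 1 / real (m + 3)"
      by (simp add: divide_simps power2_eq_square)
    with Suc show ?case by (simp add: numeral_3_eq_3)
  qed simp
  from this[of m] have "(\<Sum>a = 2..m + 2. 1 / (real a)\<^sup>2) \<le> 3 / 4"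
    by (smt (verit) divide_nonneg_nonneg of_nat_0_le_iff)
  moreover have "(\<Sum>a = 2..m. 1 / (real a)\<^sup>2) \<le> (\<Sum>a = 2..m + 2. 1 / (real a)\<^sup>2)"
    by (intro sum_mono2) auto
  ultimately show ?thesis by linarith
qed

text \<open>Union bound: of at least \<open>t - 1\<close> integers, each \<open>a\<close> from 2 to
  the floor of \<open>z\<close> removes at most \<open>t / a^2 + 1\<close>. As the inverse squares
  sum to at most \<open>3/4 < 1\<close>, a positive proportion survives.\<close>

lemma card_sieved_interval_ge:
  fixes x t z :: real
  assumes "x \<ge> 0" "t \<ge> 0" "z \<ge> 0"
  shows "real (card {n :: nat. x < real n \<and> real n \<le> x + t \<and>
      (\<forall>a\<ge>2. a\<^sup>2 dvd n \<longrightarrow> real a > z)}) \<ge> t / 4 - 1 - z"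
proof -
  let ?I = "{n :: nat. x < real n \<and> real n \<le> x + t}"
  let ?G = "{n :: nat. x < real n \<and> real n \<le> x + t \<and> (\<forall>a\<ge>2. a\<^sup>2 dvd n \<longrightarrow> real a > z)}"
  let ?B = "\<lambda>a. {n :: nat. x < real n \<and> real n \<le> x + t \<and> a\<^sup>2 dvd n}"
  define m where "m = nat \<lfloor>z\<rfloor>"
  have finI: "finite ?I" by (rule card_nat_interval[OF assms(1,2)])
  have finU: "finite (?G \<union> (\<Union>a\<in>{2..m}. ?B a))" by (rule finite_subset[OF _ finI]) auto
  have "?I \<subseteq> ?G \<union> (\<Union>a\<in>{2..m}. ?B a)"
  proof
    fix n assume n: "n \<in> ?I"
    have "n \<in> ?B a \<and> a \<in> {2..m}" if "a \<ge> 2" "a\<^sup>2 dvd n" "real a \<le> z" for a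
      using that n by (simp add: m_def le_nat_floor)
    then show "n \<in> ?G \<union> (\<Union>a\<in>{2..m}. ?B a)" using n by (fastforce simp: not_less)
  qed
  then have "card ?I \<le> card (?G \<union> (\<Union>a\<in>{2..m}. ?B a))" by (rule card_mono[OF finU])
  also have "\<dots> \<le> card ?G + (\<Sum>a = 2..m. card (?B a))"
    by (intro order.trans[OF card_Un_le] add_left_mono card_UN_le) auto
  finally have "real (card ?I) \<le> real (card ?G) + (\<Sum>a = 2..m. real (card (?B a)))"
    by (simp flip: of_nat_sum of_nat_add)
  also have "(\<Sum>a = 2..m. real (card (?B a))) \<le> (\<Sum>a = 2..m. t * (1 / (real a)\<^sup>2) + 1)"
  proof (rule sum_mono)
    fix a assume "a \<in> {2..m}"
    then show "real (card (?B a)) \<le> t * (1 / (real a)\<^sup>2) + 1"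
      using card_multiples_in_interval_le[of x t "a\<^sup>2"] assms by simp
  qed
  \<comment> \<open>Truncated subtraction gives the right number of summands 1 also for
    \<open>m = 0\<close>.\<close>
  also have "\<dots> = t * (\<Sum>a = 2..m. 1 / (real a)\<^sup>2) + real (m - 1)"
    by (simp add: sum.distrib sum_distrib_left)
  also have "\<dots> \<le> t * (3 / 4) + z"
  proof -
    have "real (m - 1) \<le> z" using assms unfolding m_def by linarith
    then show ?thesis using assms by (intro add_mono mult_left_mono sum_inverse_squares_le)
  qed
  finally show ?thesis using card_nat_interval(2)[OF assms(1,2)] by linarith
qed

section \<open>Asymptotics and the final estimate\<close>

lemma eventually_exp_ratio_le:
  fixes \<epsilon> D \<theta> :: real
  assumes "\<epsilon> > 0" "D > 0" "0 < \<theta>" "\<theta> < 1"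
  shows "eventually (\<lambda>x. D * exp (\<theta> * (ln (2 * x) / (ln x / ln (ln x)))) \<le> \<epsilon> * (ln x / ln (ln x))) at_top"
  \<comment> \<open>The exponent is \<open>\<theta> * ln (ln x) + o(1)\<close>, so the left side is
    asymptotic to \<open>D * (ln x) powr \<theta>\<close>, which is
    \<open>o(ln x / ln (ln x))\<close> because \<open>\<theta> < 1\<close>.\<close>
  using assms by real_asymp

lemma C_bounds:
  assumes "i \<ge> 2" "j \<ge> 2"
  shows "0 \<le> C i j" "C i j \<le> ln 2"
proof -
  have "1 / real i \<le> 1 / 2" "1 / real j \<le> 1 / 2" using assms by (auto simp: divide_simps)
  then have "ln 2 * (1 / real i + 1 / real j) \<le> ln 2 * 1"
    by (intro mult_left_mono) auto
  then show "C i j \<le> ln 2" by (simp add: C_def)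
qed (simp add: C_def)

text \<open>All largeness conditions on \<open>x\<close> are free of \<open>i\<close> and
  \<open>j\<close>, so that one threshold can serve every pair of exponents.\<close>

lemma sum_exp_neg_d_ge:
  fixes \<epsilon> D x L :: real
  assumes "\<epsilon> > 0" "D > 0" "i \<ge> 2" "j \<ge> 2"
    and L_def: "L = ln x / ln (ln x)"
    and x: "x > 1" "ln (ln x) > 0" "ln 16 < \<epsilon> * L" "ln 2 + 2 * \<epsilon> \<le> ln (ln x)"
    and small: "D * exp (ln 2 / (ln 2 + \<epsilon>) * (ln (2 * x) / L)) \<le> \<epsilon> * L"
  shows "(\<Sum>n\<in>{n :: nat. x < real n \<and> real n \<le> x + h \<epsilon> i j x}. exp (- D * real (d i j n)))
    \<ge> 1 / 8 * exp ((C i j + \<epsilon>) * L)"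
proof -
  define c where "c = C i j"
  define H where "H = h \<epsilon> i j x"
  define z where "z = H / 16"
  have H: "H = exp ((c + 2 * \<epsilon>) * L)" by (simp add: H_def h_def c_def L_def)
  have c: "0 \<le> c" "c \<le> ln 2" using C_bounds assms by (auto simp: c_def)
  have L0: "L > 0" using x by (simp add: L_def)
  have "(c + \<epsilon>) * L > 0" using c L0 assms by simp
  \<comment> \<open>One of the two \<epsilon> in the exponent of \<open>H\<close> pays for the
    divisor 16.\<close>
  moreover have lnz: "ln z = (c + 2 * \<epsilon>) * L - ln 16" by (simp add: z_def H ln_div)
  ultimately have lnz_ge: "ln z \<ge> (c + \<epsilon>) * L" "ln z > 0" using x by (auto simp: algebra_simps)
  have "z > 0" by (simp add: z_def H)
  with lnz_ge have z1: "z > 1" by simp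
  \<comment> \<open>Aim: \<open>H \<le> x\<close>, which keeps every \<open>n\<close> of the
    interval below or at \<open>2 * x\<close>.\<close>
  have "(c + 2 * \<epsilon>) * L \<le> ln (ln x) * L"
    using c x L0 by (intro mult_right_mono) auto
  also have "\<dots> = ln x" using x by (simp add: L_def)
  finally have "H \<le> exp (ln x)" unfolding H by simp
  then have Hx: "H \<le> x" using x by simp
  let ?I = "{n :: nat. x < real n \<and> real n \<le> x + H}"
  let ?G = "{n :: nat. x < real n \<and> real n \<le> x + H \<and> (\<forall>a\<ge>2. a\<^sup>2 dvd n \<longrightarrow> real a > z)}"
  have H0: "H \<ge> 0" by (simp add: H)
  have finI: "finite ?I" using H0 x by (intro card_nat_interval) auto
  have d_le: "D * real (d i j n) \<le> \<epsilon> * L" if n: "n \<in> ?G" for n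
  proof -
    have n0: "real n > 1" using n x by auto
    have "real (d i j n) \<le> real n powr (C i j / ln z)"
      using n n0 assms z1 by (intro d_le_powr) (auto dest: prime_ge_2_nat intro: less_imp_le)
    also have "\<dots> = exp (c / ln z * ln n)" using n0 by (simp add: powr_def c_def)
    also have "\<dots> \<le> exp (ln 2 / (ln 2 + \<epsilon>) * (ln (2 * x) / L))"
    proof -
      have "c / ln z \<le> c / ((c + \<epsilon>) * L)"
        using c lnz_ge \<open>(c + \<epsilon>) * L > 0\<close> by (intro divide_left_mono) auto
      also have "\<dots> = c / (c + \<epsilon>) / L" by simp
      \<comment> \<open>\<open>c / (c + \<epsilon>)\<close> increases with \<open>c\<close>;
        replacing \<open>c\<close> by its bound \<open>ln 2\<close> removes \<open>i\<close> and
        \<open>j\<close>.\<close>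
      also have "c / (c + \<epsilon>) \<le> ln 2 / (ln 2 + \<epsilon>)"
      proof -
        have "c * (ln 2 + \<epsilon>) \<le> ln 2 * (c + \<epsilon>)"
          using mult_right_mono[OF c(2), of \<epsilon>] assms by (simp add: algebra_simps)
        moreover have "c + \<epsilon> > 0" "ln 2 + \<epsilon> > 0" using c assms by (auto intro: add_pos_pos)
        ultimately show ?thesis by (simp add: divide_le_eq le_divide_eq)
      qed
      finally have 1: "c / ln z \<le> ln 2 / (ln 2 + \<epsilon>) / L" using L0 by (simp add: divide_right_mono)
      have "real n \<le> 2 * x" using n Hx by auto
      then have 2: "ln n \<le> ln (2 * x)" using n0 by simp
      have "c / ln z * ln n \<le> ln 2 / (ln 2 + \<epsilon>) / L * ln (2 * x)"
        using 1 2 n0 c L0 assms by (intro mult_mono) (auto intro!: divide_nonneg_nonneg add_nonneg_nonneg)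
      then show ?thesis by simp
    qed
    finally have "D * real (d i j n) \<le> D * exp (ln 2 / (ln 2 + \<epsilon>) * (ln (2 * x) / L))"
      using assms by (intro mult_left_mono) auto
    with small show ?thesis by linarith
  qed
  have "real (card ?G) \<ge> H / 4 - 1 - z"
    using H0 x z1 by (intro card_sieved_interval_ge) auto
  \<comment> \<open>\<open>H/4 - 1 - H/16 = H/8 + (z - 1)\<close>, and \<open>z > 1\<close>.\<close>
  then have cardG: "real (card ?G) \<ge> H / 8" using z1 by (simp add: z_def)
  \<comment> \<open>Each survivor contributes at least \<open>exp (- (\<epsilon> * L))\<close>,
    which lowers \<open>2 * \<epsilon>\<close> in the exponent of \<open>H\<close> to
    \<epsilon>.\<close>
  have "1 / 8 * exp ((C i j + \<epsilon>) * L) = H / 8 * exp (- (\<epsilon> * L))"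
    by (simp add: H c_def algebra_simps flip: exp_add)
  also have "\<dots> \<le> real (card ?G) * exp (- (\<epsilon> * L))"
    using cardG by (intro mult_right_mono) auto
  also have "\<dots> = (\<Sum>n\<in>?G. exp (- (\<epsilon> * L)))" by simp
  also have "\<dots> \<le> (\<Sum>n\<in>?G. exp (- D * real (d i j n)))"
    using d_le by (intro sum_mono) auto
  also have "\<dots> \<le> (\<Sum>n\<in>?I. exp (- D * real (d i j n)))"
    by (intro sum_mono2 finI) auto
  finally show ?thesis by (simp add: H_def)
qed

theorem lemma5:
  fixes \<epsilon> D :: real
  assumes "\<epsilon> > 0" and "D > 0"
  shows "\<exists>E N :: real. E > 0 \<and> N > 0 \<and>
    (\<forall>i j :: nat. i \<ge> 2 \<longrightarrow> j \<ge> 2 \<longrightarrow>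
      (\<forall>x :: real. x > N \<longrightarrow>
        (\<Sum>n\<in>{n :: nat. x < real n \<and> real n \<le> x + h \<epsilon> i j x}. exp (- D * real (d i j n)))
          \<ge> E * exp ((C i j + \<epsilon>) * (ln x / ln (ln x)))))"
proof -
  \<comment> \<open>The value of \<open>c / (c + \<epsilon>)\<close> in the extreme case
    \<open>i = j = 2\<close>, where \<open>C i j = ln 2\<close>.\<close>
  define \<theta> where "\<theta> = ln 2 / (ln 2 + \<epsilon>)"
  have \<theta>: "0 < \<theta>" "\<theta> < 1" using assms by (auto simp: \<theta>_def divide_simps add_pos_pos)
  have "eventually (\<lambda>x::real. x > 1 \<and> ln (ln x) > 0 \<and> ln 16 < \<epsilon> * (ln x / ln (ln x))
      \<and> ln 2 + 2 * \<epsilon> \<le> ln (ln x)) at_top"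
    using assms by (intro eventually_conj; real_asymp)
  then have "eventually (\<lambda>x::real. (x > 1 \<and> ln (ln x) > 0 \<and> ln 16 < \<epsilon> * (ln x / ln (ln x))
      \<and> ln 2 + 2 * \<epsilon> \<le> ln (ln x)) \<and>
      D * exp (\<theta> * (ln (2 * x) / (ln x / ln (ln x)))) \<le> \<epsilon> * (ln x / ln (ln x))) at_top"
    using eventually_exp_ratio_le[OF assms \<theta>] by (rule eventually_conj)
  then obtain N where N: "\<And>x. x \<ge> N \<Longrightarrow> (x > 1 \<and> ln (ln x) > 0 \<and> ln 16 < \<epsilon> * (ln x / ln (ln x))
      \<and> ln 2 + 2 * \<epsilon> \<le> ln (ln x)) \<and>
      D * exp (\<theta> * (ln (2 * x) / (ln x / ln (ln x)))) \<le> \<epsilon> * (ln x / ln (ln x))"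
    unfolding eventually_at_top_linorder by blast
  \<comment> \<open>Taking \<open>max N 1\<close> makes the threshold positive.\<close>
  have "1 / 8 * exp ((C i j + \<epsilon>) * (ln x / ln (ln x)))
      \<le> (\<Sum>n\<in>{n :: nat. x < real n \<and> real n \<le> x + h \<epsilon> i j x}. exp (- D * real (d i j n)))"
    if "i \<ge> 2" "j \<ge> 2" "x > max N 1" for i j x
    using N[of x] that assms by (intro sum_exp_neg_d_ge) (auto simp: \<theta>_def)
  then show ?thesis
    by (intro exI[of _ "1 / 8"] exI[of _ "max N 1"]) auto
qed

end
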